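(* Let $G$ be a connected unicyclic simple graph with $n$ vertices whose unique cycle has length $c$, and fix an integer $1\leq\ell\leq n$. Let $X_G=\sum_{\lambda\vdash n}c_\lambda\,\mathfrak{st}_\lambda$ be the expansion of its chromatic symmetric function in the star basis, and let $\sigma_\ell(G)=\sum_{\lambda\vdash n:\ \ell(\lambda)=\ell}c_\lambda$. Then $$\sigma_\ell(G)=(-1)^{\ell-1}\binom{c-1}{\ell}.$$
   Context: For a finite simple graph $G=(V,E)$, a proper colouring is a function $\kappa:V\to\{1,2,3,\ldots\}$ with $\kappa(u)\neq\kappa(v)$ whenever $\{u,v\}\in E$. The chromatic symmetric function of $G$ is $X_G=\sum_{\kappa\text{ proper}}\prod_{v\in V}x_{\kappa(v)}$, a symmetric function in commuting variables $x_1,x_2,\ldots$, homogeneous of degree $|V|$. The star $\mathrm{St}_k$ is the $k$-vertex tree in which $k-1$ leaves are joined to a single central vertex ($\mathrm{St}_1$ is a single vertex). For a partition $\lambda=(\lambda_1,\ldots,\lambda_r)$ of $n$, its length is $\ell(\lambda)=r$, the graph $\mathrm{St}_\lambda$ is the disjoint union of $\mathrm{St}_{\lambda_1},\ldots,\mathrm{St}_{\lambda_r}$, and $\mathfrak{st}_\lambda=X_{\mathrm{St}_\lambda}$. It is known that $\{\mathfrak{st}_\lambda:\lambda\vdash n\}$ is a basis (over $\mathbb{Q}$) of the space of symmetric functions of degree $n$, called the star basis. A unicyclic graph is a graph with exactly one cycle. *)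

theory Defs
  imports Complex_Main "HOL-Library.FuncSet" "HOL-Library.Multiset"
begin

text \<open>A finite simple graph is given by its vertex set and its set of edges, the latter being
  two-element sets of vertices.\<close>

definition simple_graph :: "'a set \<Rightarrow> 'a set set \<Rightarrow> bool" where
  "simple_graph V E \<longleftrightarrow> finite V \<and> (\<forall>e\<in>E. e \<subseteq> V \<and> card e = 2)"

definition connected_graph :: "'a set \<Rightarrow> 'a set set \<Rightarrow> bool" where
  "connected_graph V E \<longleftrightarrow> V \<noteq> {} \<and> (\<forall>u\<in>V. \<forall>v\<in>V. (u, v) \<in> {(x, y). {x, y} \<in> E}\<^sup>*)"

text \<open>A cycle is a subgraph, not a vertex sequence: the \<open>2 * k\<close> cyclic sequences that run
  through the same \<open>k\<close> edges are one and the same cycle. As a subgraph without isolated vertices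
  it is determined by its edge set, which represents it here; its length is the number of
  its edges.\<close>

definition cyclic_edges :: "'a list \<Rightarrow> 'a set set" where
  "cyclic_edges vs = {{vs ! i, vs ! (Suc i mod length vs)} | i. i < length vs}"

definition is_cycle :: "'a set set \<Rightarrow> 'a set set \<Rightarrow> bool" where
  "is_cycle E C \<longleftrightarrow> C \<subseteq> E \<and> (\<exists>vs. distinct vs \<and> length vs \<ge> 3 \<and> C = cyclic_edges vs)"

definition unicyclic :: "'a set set \<Rightarrow> bool" where
  "unicyclic E \<longleftrightarrow> (\<exists>!C. is_cycle E C)"

definition proper_colourings :: "'a set \<Rightarrow> 'a set set \<Rightarrow> ('a \<Rightarrow> nat) set" where
  "proper_colourings V E =
     {\<kappa> \<in> V \<rightarrow>\<^sub>E {1..}. \<forall>u\<in>V. \<forall>v\<in>V. {u, v} \<in> E \<longrightarrow> \<kappa> u \<noteq> \<kappa> v}"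

text \<open>A formal power series over the rationals in commuting variables \<open>x\<^sub>1, x\<^sub>2, \<dots>\<close> is given by its
  coefficient function. A monomial is the multiset of the indices of its variables, so that
  \<open>\<Prod>v\<in>V. x\<^bsub>\<kappa> v\<^esub>\<close> is \<open>image_mset \<kappa> (mset_set V)\<close>. The chromatic symmetric function, being
  the sum of these monomials over all proper colourings, has as its coefficient at \<open>m\<close> the number
  of proper colourings with monomial \<open>m\<close>.\<close>

definition chromatic_symmetric :: "'a set \<Rightarrow> 'a set set \<Rightarrow> nat multiset \<Rightarrow> rat" where
  "chromatic_symmetric V E m =
     of_nat (card {\<kappa> \<in> proper_colourings V E. image_mset \<kappa> (mset_set V) = m})"

lemma finite_proper_colourings_monomial:
  assumes "finite V"
  shows "finite {\<kappa> \<in> proper_colourings V E. image_mset \<kappa> (mset_set V) = m}"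
proof (rule finite_subset)
  show "{\<kappa> \<in> proper_colourings V E. image_mset \<kappa> (mset_set V) = m} \<subseteq> V \<rightarrow>\<^sub>E set_mset m"
    using assms by (auto simp: proper_colourings_def PiE_iff extensional_def)
  show "finite (V \<rightarrow>\<^sub>E set_mset m)"
    using assms by (simp add: finite_PiE)
qed

definition partitions_of :: "nat \<Rightarrow> nat list set" where
  "partitions_of n = {p. sorted_wrt (\<ge>) p \<and> (\<forall>k\<in>set p. k \<ge> 1) \<and> sum_list p = n}"

lemma finite_partitions_of: "finite (partitions_of n)"
proof (rule finite_subset)
  have "length p \<le> sum_list p" if "\<forall>k\<in>set p. k \<ge> 1" for p :: "nat list"
    using that by (induction p) auto
  then show "partitions_of n \<subseteq> {p. set p \<subseteq> {..n} \<and> length p \<le> n}"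
    using member_le_sum_list by (fastforce simp: partitions_of_def)
  show "finite {p. set p \<subseteq> {..n} \<and> length p \<le> n}"
    by (rule finite_lists_length_le) simp
qed

text \<open>The star on \<open>k\<close> vertices has centre \<open>0\<close>.\<close>

definition star_verts :: "nat \<Rightarrow> nat set" where
  "star_verts k = {0..<k}"

definition star_edges :: "nat \<Rightarrow> nat set set" where
  "star_edges k = {{0, j} | j. 1 \<le> j \<and> j < k}"

text \<open>The disjoint union of the stars belonging to the parts of \<open>p\<close>: the vertices of the \<open>i\<close>-th
  star are tagged with \<open>i\<close>.\<close>

definition star_forest_verts :: "nat list \<Rightarrow> (nat \<times> nat) set" where
  "star_forest_verts p = (SIGMA i:{..<length p}. star_verts (p ! i))"

definition star_forest_edges :: "nat list \<Rightarrow> (nat \<times> nat) set set" where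
  "star_forest_edges p = (\<Union>i<length p. (\<lambda>e. Pair i ` e) ` star_edges (p ! i))"

definition star_sym :: "nat list \<Rightarrow> nat multiset \<Rightarrow> rat" where
  "star_sym p = chromatic_symmetric (star_forest_verts p) (star_forest_edges p)"

end

theory Submission
  imports Defs "HOL-Computational_Algebra.Polynomial"
begin

text \<open>
  Put \<open>x\<^sub>1 = \<dots> = x\<^sub>q = 1\<close> and all other variables \<open>0\<close>. This turns the chromatic symmetric function
  of a graph into its number of proper colourings with \<open>q\<close> colours, and it is linear, so the star
  expansion becomes an identity between chromatic polynomials. It forgets exactly the right amount:
  a star forest with \<open>l\<close> components on \<open>n\<close> vertices has \<open>q\<^sup>l * (q - 1)\<^bsup>n - l\<^esup>\<close> colourings
  (\<open>chromatic_count_star_forest\<close>), which depends on \<open>\<lambda>\<close> only through its length. Hence the star side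
  is \<open>\<Sum>l\<le>n. \<sigma>\<^sub>l * q\<^sup>l * (q - 1)\<^bsup>n - l\<^esup>\<close> (\<open>chromatic_count_star_expansion\<close>).

  A connected unicyclic graph arises from its cycle by attaching pendant vertices one at a time,
  each of which multiplies the number of colourings by \<open>q - 1\<close>. Together with the count
  \<open>(q - 1)\<^sup>c + (-1)\<^sup>c * (q - 1)\<close> for the cycle (\<open>chromatic_count_cycle\<close>) this evaluates the other side
  (\<open>chromatic_count_unicyclic\<close>).

  Dividing both sides by \<open>(q - 1)\<^sup>n\<close> and writing \<open>y = q / (q - 1)\<close>, so that
  \<open>1 / (q - 1) = y - 1\<close>, gives
  \<open>(\<Sum>l\<le>n. \<sigma>\<^sub>l * y\<^sup>l) = 1 + (-1)\<^sup>c * (y - 1)\<^bsup>c - 1\<^esup> = 1 - (1 - y)\<^bsup>c - 1\<^esup>\<close>.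
  It holds for infinitely many \<open>y\<close>, so the coefficients at \<open>y\<^sup>l\<close> agree.
\<close>

section \<open>Colourings with a bounded number of colours\<close>

definition bounded_colourings :: "'a set \<Rightarrow> 'a set set \<Rightarrow> nat \<Rightarrow> ('a \<Rightarrow> nat) set" where
  "bounded_colourings V E q =
     {\<kappa> \<in> V \<rightarrow>\<^sub>E {1..q}. \<forall>u\<in>V. \<forall>v\<in>V. {u, v} \<in> E \<longrightarrow> \<kappa> u \<noteq> \<kappa> v}"

lemma bounded_colouringsI:
  assumes "\<And>u v. u \<in> V \<Longrightarrow> v \<in> V \<Longrightarrow> {u, v} \<in> E \<Longrightarrow> \<kappa> u \<noteq> \<kappa> v"
    and "\<And>v. v \<in> V \<Longrightarrow> \<kappa> v \<in> {1..q}" and "\<And>v. v \<notin> V \<Longrightarrow> \<kappa> v = undefined"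
  shows "\<kappa> \<in> bounded_colourings V E q"
  using assms by (simp add: bounded_colourings_def PiE_iff extensional_def)

lemma
  assumes "\<kappa> \<in> bounded_colourings V E q"
  shows bounded_colourings_range: "v \<in> V \<Longrightarrow> \<kappa> v \<in> {1..q}"
    and bounded_colourings_outside: "v \<notin> V \<Longrightarrow> \<kappa> v = undefined"
    and bounded_colourings_proper: "u \<in> V \<Longrightarrow> v \<in> V \<Longrightarrow> {u, v} \<in> E \<Longrightarrow> \<kappa> u \<noteq> \<kappa> v"
  using assms by (auto simp: bounded_colourings_def PiE_iff extensional_def)

definition chromatic_count :: "'a set \<Rightarrow> 'a set set \<Rightarrow> nat \<Rightarrow> rat" where
  "chromatic_count V E q = of_nat (card (bounded_colourings V E q))"

lemma finite_bounded_colourings: "finite V \<Longrightarrow> finite (bounded_colourings V E q)"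
  by (rule finite_subset[of _ "V \<rightarrow>\<^sub>E {1..q}"]) (auto simp: bounded_colourings_def intro: finite_PiE)

text \<open>The monomials of degree \<open>n\<close> in \<open>x\<^sub>1, \<dots>, x\<^sub>q\<close>, presented as the image of a finite set of
  lists to make their finiteness evident.\<close>

definition monomials :: "nat \<Rightarrow> nat \<Rightarrow> nat multiset set" where
  "monomials n q = mset ` {xs. set xs \<subseteq> {1..q} \<and> length xs = n}"

lemma finite_monomials: "finite (monomials n q)"
  unfolding monomials_def by (intro finite_imageI finite_lists_length_eq) simp

lemma mem_monomials: "m \<in> monomials n q \<longleftrightarrow> set_mset m \<subseteq> {1..q} \<and> size m = n"
proof
  assume "set_mset m \<subseteq> {1..q} \<and> size m = n"
  moreover obtain xs where "mset xs = m" using ex_mset by blast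
  ultimately show "m \<in> monomials n q" unfolding monomials_def by force
qed (auto simp: monomials_def)

text \<open>Setting \<open>q\<close> variables to \<open>1\<close> and the others to \<open>0\<close>: a homogeneous series of degree \<open>n\<close> is sent
  to the sum of its coefficients over the surviving monomials. Sorting the colourings by their
  monomial identifies the result for a chromatic symmetric function.\<close>

lemma sum_chromatic_symmetric:
  assumes "finite V" and "card V = n"
  shows "(\<Sum>m\<in>monomials n q. chromatic_symmetric V E m) = chromatic_count V E q"
proof -
  let ?mon = "\<lambda>\<kappa>. image_mset \<kappa> (mset_set V)"
  let ?F = "\<lambda>m. {\<kappa> \<in> proper_colourings V E. ?mon \<kappa> = m}"
  have "bounded_colourings V E q = (\<Union>m\<in>monomials n q. ?F m)"
  proof (rule set_eqI)
    fix \<kappa>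
    have "\<kappa> \<in> bounded_colourings V E q \<longleftrightarrow> \<kappa> \<in> proper_colourings V E \<and> \<kappa> ` V \<subseteq> {1..q}"
      by (auto simp: bounded_colourings_def proper_colourings_def PiE_iff image_subset_iff)
    also have "\<dots> \<longleftrightarrow> \<kappa> \<in> (\<Union>m\<in>monomials n q. ?F m)"
      using assms by (simp add: mem_monomials)
    finally show "\<kappa> \<in> bounded_colourings V E q \<longleftrightarrow> \<kappa> \<in> (\<Union>m\<in>monomials n q. ?F m)" .
  qed
  then have "card (bounded_colourings V E q) = (\<Sum>m\<in>monomials n q. card (?F m))"
    using finite_monomials finite_proper_colourings_monomial[OF assms(1)]
    by (simp only:) (rule card_UN_disjoint, auto)
  then show ?thesis by (simp add: chromatic_count_def chromatic_symmetric_def)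
qed

lemma chromatic_count_empty [simp]: "chromatic_count {} E q = 1"
proof -
  have "bounded_colourings {} E q = {\<lambda>_. undefined}" by (auto simp: bounded_colourings_def)
  then show ?thesis by (simp add: chromatic_count_def)
qed

text \<open>The single recursion behind every count below: a colouring extends to a new vertex by any
  colour that its neighbours do not use. For \<open>U\<close> empty or a singleton the number of forbidden colours
  is constant; for a two-element \<open>U\<close>, as in closing a cycle, it depends on whether the two neighbours
  agree.\<close>

lemma chromatic_count_new_vertex:
  assumes "finite V" and "v \<notin> V" and "\<Union>E \<subseteq> V" and "U \<subseteq> V"
  shows "chromatic_count (insert v V) (E \<union> (\<lambda>u. {u, v}) ` U) q =
    (\<Sum>\<kappa>\<in>bounded_colourings V E q. of_nat q - of_nat (card (\<kappa> ` U)))"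
proof -
  let ?K = "bounded_colourings V E q"
  let ?S = "SIGMA \<kappa>:?K. {1..q} - \<kappa> ` U"
  define E' where "E' = E \<union> (\<lambda>u. {u, v}) ` U"
  have old: "e \<in> E \<Longrightarrow> e \<subseteq> V" for e using assms(3) by blast
  have edge: "{x, y} \<in> E' \<longleftrightarrow> {x, y} \<in> E \<or> (x \<in> U \<and> y = v) \<or> (y \<in> U \<and> x = v)" for x y
    unfolding E'_def by (auto simp: doubleton_eq_iff image_iff)
  have "bij_betw (\<lambda>(\<kappa>, c). \<kappa>(v := c)) ?S (bounded_colourings (insert v V) E' q)"
  proof (rule bij_betw_byWitness[where f' = "\<lambda>\<kappa>. (restrict \<kappa> V, \<kappa> v)"])
    have "restrict (\<kappa>(v := c)) V = \<kappa>" if "\<kappa> \<in> ?K" for \<kappa> c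
    proof
      fix x show "restrict (\<kappa>(v := c)) V x = \<kappa> x"
        using bounded_colourings_outside[OF that] assms(2) by (cases "x \<in> V") auto
    qed
    then show "\<forall>p\<in>?S. (\<lambda>\<kappa>. (restrict \<kappa> V, \<kappa> v)) ((\<lambda>(\<kappa>, c). \<kappa>(v := c)) p) = p"
      by auto
    have "(restrict \<kappa> V)(v := \<kappa> v) = \<kappa>" if "\<kappa> \<in> bounded_colourings (insert v V) E' q" for \<kappa>
    proof
      fix x show "((restrict \<kappa> V)(v := \<kappa> v)) x = \<kappa> x"
        using bounded_colourings_outside[OF that, of x] by (cases "x \<in> V") auto
    qed
    then show "\<forall>\<kappa>\<in>bounded_colourings (insert v V) E' q.
        (\<lambda>(\<kappa>, c). \<kappa>(v := c)) (restrict \<kappa> V, \<kappa> v) = \<kappa>"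
      by simp
    have "\<kappa>(v := c) \<in> bounded_colourings (insert v V) E' q"
      if \<kappa>: "\<kappa> \<in> ?K" and c: "c \<in> {1..q}" "c \<notin> \<kappa> ` U" for \<kappa> c
    proof (rule bounded_colouringsI)
      fix x y assume "{x, y} \<in> E'"
      then consider "{x, y} \<in> E" | "x \<in> U" "y = v" | "y \<in> U" "x = v"
        unfolding edge by blast
      then show "(\<kappa>(v := c)) x \<noteq> (\<kappa>(v := c)) y"
      proof cases
        case 1
        then have "x \<in> V" "y \<in> V" "x \<noteq> v" "y \<noteq> v" using old[OF 1] assms(2) by auto
        then show ?thesis using bounded_colourings_proper[OF \<kappa> _ _ 1] by simp
      next
        case 2
        then have "x \<noteq> v" using assms(2,4) by blast
        then show ?thesis using 2 c(2) by auto
      next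
        case 3
        then have "y \<noteq> v" using assms(2,4) by blast
        then show ?thesis using 3 c(2) by auto
      qed
    next
      fix x assume "x \<in> insert v V"
      then show "(\<kappa>(v := c)) x \<in> {1..q}"
        using bounded_colourings_range[OF \<kappa>, of x] c(1) by (cases "x = v") auto
    next
      fix x assume "x \<notin> insert v V"
      then show "(\<kappa>(v := c)) x = undefined" using bounded_colourings_outside[OF \<kappa>, of x] by simp
    qed
    then show "(\<lambda>(\<kappa>, c). \<kappa>(v := c)) ` ?S \<subseteq> bounded_colourings (insert v V) E' q"
      by clarify
    have "restrict \<kappa> V \<in> ?K \<and> \<kappa> v \<in> {1..q} - restrict \<kappa> V ` U"
      if \<kappa>: "\<kappa> \<in> bounded_colourings (insert v V) E' q" for \<kappa>
    proof
      show "restrict \<kappa> V \<in> ?K"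
      proof (rule bounded_colouringsI)
        fix x y assume xy: "x \<in> V" "y \<in> V" "{x, y} \<in> E"
        then have "{x, y} \<in> E'" by (simp add: edge)
        then show "restrict \<kappa> V x \<noteq> restrict \<kappa> V y"
          using bounded_colourings_proper[OF \<kappa>, of x y] xy by simp
      qed (use bounded_colourings_range[OF \<kappa>] in simp_all)
      have "\<kappa> v \<noteq> \<kappa> u" if "u \<in> U" for u
      proof -
        have "{u, v} \<in> E'" "u \<in> V" using that assms(4) by (auto simp: edge)
        then show ?thesis using bounded_colourings_proper[OF \<kappa>, of u v] by simp
      qed
      moreover have "restrict \<kappa> V ` U = \<kappa> ` U" using assms(4) by (intro image_cong) auto
      ultimately show "\<kappa> v \<in> {1..q} - restrict \<kappa> V ` U"
        using bounded_colourings_range[OF \<kappa>, of v] by auto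
    qed
    then show "(\<lambda>\<kappa>. (restrict \<kappa> V, \<kappa> v)) ` bounded_colourings (insert v V) E' q \<subseteq> ?S"
      by blast
  qed
  then have "card (bounded_colourings (insert v V) E' q) = card ?S"
    by (simp add: bij_betw_same_card)
  also have "\<dots> = (\<Sum>\<kappa>\<in>?K. card ({1..q} - \<kappa> ` U))"
    using finite_bounded_colourings[OF assms(1)] by (simp add: card_SigmaI)
  finally have "chromatic_count (insert v V) E' q = (\<Sum>\<kappa>\<in>?K. of_nat (card ({1..q} - \<kappa> ` U)))"
    by (simp add: chromatic_count_def)
  also have "\<dots> = (\<Sum>\<kappa>\<in>?K. of_nat q - of_nat (card (\<kappa> ` U)))"
  proof (rule sum.cong)
    fix \<kappa> assume "\<kappa> \<in> ?K"
    then have sub: "\<kappa> ` U \<subseteq> {1..q}"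
      using assms(4) by (auto simp: bounded_colourings_def PiE_iff)
    then have "card ({1..q} - \<kappa> ` U) = q - card (\<kappa> ` U)"
      by (simp add: card_Diff_subset finite_subset)
    moreover have "card (\<kappa> ` U) \<le> q" using card_mono[OF _ sub] by simp
    ultimately show "of_nat (card ({1..q} - \<kappa> ` U)) = (of_nat q - of_nat (card (\<kappa> ` U)) :: rat)"
      by (simp add: of_nat_diff)
  qed simp
  finally show ?thesis unfolding E'_def .
qed

lemma chromatic_count_isolated_vertex:
  assumes "finite V" and "v \<notin> V" and "\<Union>E \<subseteq> V"
  shows "chromatic_count (insert v V) E q = of_nat q * chromatic_count V E q"
  using chromatic_count_new_vertex[OF assms, of "{}" q] by (simp add: chromatic_count_def)

lemma chromatic_count_pendant_vertex:
  assumes "finite V" and "v \<notin> V" and "\<Union>E \<subseteq> V" and "u \<in> V"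
  shows "chromatic_count (insert v V) (insert {u, v} E) q =
    (of_nat q - 1) * chromatic_count V E q"
  using chromatic_count_new_vertex[OF assms(1-3), of "{u}" q] assms(4)
  by (simp add: chromatic_count_def)

section \<open>Star forests\<close>

lemma star_forest_verts_snoc:
  "star_forest_verts (p @ [k]) = star_forest_verts p \<union> Pair (length p) ` {0..<k}"
proof -
  have "star_forest_verts p = (SIGMA i:{..<length p}. {0..<(p @ [k]) ! i})"
    unfolding star_forest_verts_def star_verts_def by (intro Sigma_cong) (auto simp: nth_append)
  moreover have "star_forest_verts (p @ [k]) =
      (SIGMA i:insert (length p) {..<length p}. {0..<(p @ [k]) ! i})"
    by (simp add: star_forest_verts_def star_verts_def lessThan_Suc)
  ultimately show ?thesis by auto
qed

lemma star_forest_edges_snoc: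
  "star_forest_edges (p @ [k]) =
     star_forest_edges p \<union> (\<lambda>j. {(length p, 0), (length p, j)}) ` {1..<k}"
proof -
  have "star_edges k = (\<lambda>j. {0, j}) ` {1..<k}"
    unfolding star_edges_def atLeastLessThan_def by blast
  then have "(\<lambda>e. Pair (length p) ` e) ` star_edges k =
      (\<lambda>j. {(length p, 0), (length p, j)}) ` {1..<k}"
    by (simp add: image_image)
  moreover have "star_forest_edges (p @ [k]) =
     star_forest_edges p \<union> (\<lambda>e. Pair (length p) ` e) ` star_edges k"
    by (simp add: star_forest_edges_def lessThan_Suc nth_append Un_commute)
  ultimately show ?thesis by simp
qed

lemma finite_star_forest_verts: "finite (star_forest_verts p)"
  by (simp add: star_forest_verts_def star_verts_def)

lemma card_star_forest_verts: "card (star_forest_verts p) = sum_list p"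
  by (simp add: star_forest_verts_def star_verts_def sum_list_sum_nth atLeast0LessThan)

lemma star_forest_edges_subset: "\<Union>(star_forest_edges p) \<subseteq> star_forest_verts p"
  unfolding star_forest_edges_def star_edges_def star_forest_verts_def star_verts_def by auto

lemma chromatic_count_star_forest_snoc:
  "chromatic_count (star_forest_verts (p @ [Suc k])) (star_forest_edges (p @ [Suc k])) q =
     of_nat q * (of_nat q - 1) ^ k *
     chromatic_count (star_forest_verts p) (star_forest_edges p) q"
proof (induction k)
  case 0
  have "(length p, 0) \<notin> star_forest_verts p" by (simp add: star_forest_verts_def)
  from chromatic_count_isolated_vertex[OF finite_star_forest_verts this star_forest_edges_subset]
  show ?case by (simp add: star_forest_verts_snoc star_forest_edges_snoc)
next
  case (Suc k)
  let ?p = "p @ [Suc k]" and ?v = "(length p, Suc k)"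
  have new: "?v \<notin> star_forest_verts ?p" and centre: "(length p, 0) \<in> star_forest_verts ?p"
    by (auto simp: star_forest_verts_def star_verts_def)
  have "star_forest_verts (p @ [Suc (Suc k)]) = insert ?v (star_forest_verts ?p)"
    and "star_forest_edges (p @ [Suc (Suc k)]) =
      insert {(length p, 0), ?v} (star_forest_edges ?p)"
    by (simp_all add: star_forest_verts_snoc star_forest_edges_snoc atLeastLessThanSuc)
  then show ?case
    using chromatic_count_pendant_vertex[OF finite_star_forest_verts new
        star_forest_edges_subset centre] Suc.IH
    by simp
qed

lemma length_le_sum_list: "\<forall>k\<in>set p. k \<ge> 1 \<Longrightarrow> length p \<le> sum_list (p :: nat list)"
  by (induction p) auto

text \<open>The centre of each star is a free choice among \<open>q\<close> colours, and each leaf only has to avoid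
  its centre; therefore the sizes of the stars matter only through their number.\<close>

lemma chromatic_count_star_forest:
  assumes "\<forall>k\<in>set p. k \<ge> 1"
  shows "chromatic_count (star_forest_verts p) (star_forest_edges p) q =
    of_nat q ^ length p * (of_nat q - 1) ^ (sum_list p - length p)"
  using assms
proof (induction p rule: rev_induct)
  case Nil
  show ?case by (simp add: star_forest_verts_def)
next
  case (snoc k p)
  then obtain j where j: "k = Suc j" by (cases k) auto
  have "sum_list (p @ [k]) - length (p @ [k]) = j + (sum_list p - length p)"
    using length_le_sum_list[of p] snoc.prems j by simp
  then show ?case
    using snoc j by (simp add: chromatic_count_star_forest_snoc power_add del: sum_list_append)
qed

section \<open>Paths and cycles\<close>

definition path_edges :: "'a list \<Rightarrow> 'a set set" where
  "path_edges vs = {{vs ! i, vs ! Suc i} | i. Suc i < length vs}"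

lemma path_edges_singleton [simp]: "path_edges [v] = {}"
  by (simp add: path_edges_def)

lemma path_edges_snoc:
  assumes "vs \<noteq> []"
  shows "path_edges (vs @ [v]) = insert {last vs, v} (path_edges vs)"
proof -
  let ?k = "length vs - 1"
  have path: "path_edges xs = (\<lambda>i. {xs ! i, xs ! Suc i}) ` {..<length xs - 1}" for xs :: "'a list"
    by (auto simp: path_edges_def)
  have "length (vs @ [v]) - 1 = Suc ?k" using assms by (cases vs) auto
  moreover have "(\<lambda>i. {(vs @ [v]) ! i, (vs @ [v]) ! Suc i}) ` {..<?k} =
      (\<lambda>i. {vs ! i, vs ! Suc i}) ` {..<?k}"
    by (rule image_cong) (auto simp: nth_append)
  moreover have "(vs @ [v]) ! ?k = last vs" "(vs @ [v]) ! Suc ?k = v"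
    using assms by (auto simp: nth_append last_conv_nth)
  ultimately show ?thesis by (simp only: path lessThan_Suc image_insert)
qed

lemma path_edges_append_subset: "path_edges xs \<subseteq> path_edges (xs @ ys)"
  by (force simp: path_edges_def nth_append)

lemma path_edges_subset: "\<Union>(path_edges vs) \<subseteq> set vs"
  by (auto simp: path_edges_def)

lemma cyclic_edges_eq:
  assumes "vs \<noteq> []"
  shows "cyclic_edges vs = insert {last vs, hd vs} (path_edges vs)"
proof -
  let ?k = "length vs - 1"
  let ?e = "\<lambda>i. {vs ! i, vs ! (Suc i mod length vs)}"
  have "{..<length vs} = insert ?k {..<?k}" using assms by (cases vs) (auto simp: lessThan_Suc)
  moreover have "cyclic_edges vs = ?e ` {..<length vs}" by (auto simp: cyclic_edges_def)
  ultimately have "cyclic_edges vs = insert (?e ?k) (?e ` {..<?k})" by (simp only: image_insert)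
  moreover have "?e ` {..<?k} = (\<lambda>i. {vs ! i, vs ! Suc i}) ` {..<?k}"
    by (rule image_cong) auto
  moreover have "path_edges vs = (\<lambda>i. {vs ! i, vs ! Suc i}) ` {..<?k}"
    by (auto simp: path_edges_def)
  moreover have "?e ?k = {last vs, hd vs}"
    using assms by (simp add: last_conv_nth hd_conv_nth)
  ultimately show ?thesis by simp
qed

lemma Union_cyclic_edges: "\<Union>(cyclic_edges vs) = set vs"
proof
  show "\<Union>(cyclic_edges vs) \<subseteq> set vs"
    by (cases "vs = []") (auto simp: cyclic_edges_def)
  show "set vs \<subseteq> \<Union>(cyclic_edges vs)"
  proof
    fix v assume "v \<in> set vs"
    then obtain i where "i < length vs" "v = vs ! i" by (metis in_set_conv_nth)
    then show "v \<in> \<Union>(cyclic_edges vs)" unfolding cyclic_edges_def by blast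
  qed
qed

text \<open>The two edges coincide for \<open>length vs = 2\<close>, so at least three vertices are needed for
  the indices to enumerate the edges without repetition.\<close>

lemma card_cyclic_edges:
  assumes "distinct vs" and "length vs \<ge> 3"
  shows "card (cyclic_edges vs) = length vs"
proof -
  let ?n = "length vs"
  let ?s = "\<lambda>i. Suc i mod ?n"
  have succ: "?s i = (if Suc i = ?n then 0 else Suc i)" if "i < ?n" for i
    using that by auto
  have "inj_on (\<lambda>i. {vs ! i, vs ! ?s i}) {..<?n}"
  proof (rule inj_onI)
    fix i j assume ij: "i \<in> {..<?n}" "j \<in> {..<?n}"
      and eq: "{vs ! i, vs ! ?s i} = {vs ! j, vs ! ?s j}"
    have lt: "?s i < ?n" "?s j < ?n" using assms(2) by (auto intro: mod_less_divisor)
    have "i = j \<or> (i = ?s j \<and> ?s i = j)"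
      using eq ij lt nth_eq_iff_index_eq[OF assms(1)] unfolding doubleton_eq_iff by auto
    then show "i = j" using succ ij assms(2) by (auto split: if_splits)
  qed
  moreover have "cyclic_edges vs = (\<lambda>i. {vs ! i, vs ! ?s i}) ` {..<?n}"
    by (auto simp: cyclic_edges_def)
  ultimately show ?thesis by (simp add: card_image)
qed

lemma chromatic_count_path:
  assumes "vs \<noteq> []" and "distinct vs"
  shows "chromatic_count (set vs) (path_edges vs) q = of_nat q * (of_nat q - 1) ^ (length vs - 1)"
  using assms
proof (induction vs rule: rev_nonempty_induct)
  case (single v)
  show ?case using chromatic_count_isolated_vertex[of "{}" v "{}" q] by simp
next
  case (snoc v vs)
  then have "v \<notin> set vs" "last vs \<in> set vs" by auto
  from chromatic_count_pendant_vertex[OF finite_set this(1) path_edges_subset this(2)]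
  have "chromatic_count (set (vs @ [v])) (path_edges (vs @ [v])) q =
      (of_nat q - 1) * chromatic_count (set vs) (path_edges vs) q"
    using snoc.hyps by (simp add: path_edges_snoc)
  then show ?case using snoc by (cases vs) auto
qed

text \<open>Adding a vertex \<open>v\<close> to a path and joining it to both ends leaves \<open>q - 2\<close> colours for \<open>v\<close> if the
  ends differ and \<open>q - 1\<close> if they agree. The path colourings with different ends are the colourings
  of the shorter cycle, so the counts satisfy \<open>C\<^bsub>k + 1\<^esub> = (q - 1) * P\<^sub>k - C\<^sub>k\<close>. The recursion may
  start at \<open>k = 1\<close>, where the closing edge degenerates to \<open>{v}\<close> and admits no colouring, in
  accordance with the formula.\<close>

lemma chromatic_count_cycle:
  assumes "vs \<noteq> []" and "distinct vs"
  shows "chromatic_count (set vs) (cyclic_edges vs) q =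
    (of_nat q - 1) ^ length vs + (-1) ^ length vs * (of_nat q - 1)"
  using assms
proof (induction vs rule: rev_nonempty_induct)
  case (single v)
  have "bounded_colourings {v} (cyclic_edges [v]) q = {}"
    by (auto simp: bounded_colourings_def cyclic_edges_eq)
  then show ?case by (simp add: chromatic_count_def)
next
  case (snoc v vs)
  let ?P = "bounded_colourings (set vs) (path_edges vs) q"
  let ?C = "bounded_colourings (set vs) (cyclic_edges vs) q"
  let ?Q = "of_nat q :: rat"
  have ends: "last vs \<in> set vs" "hd vs \<in> set vs" using snoc.hyps by auto
  have v: "v \<notin> set vs" using snoc.prems by simp
  have fin: "finite ?P" by (simp add: finite_bounded_colourings)
  have "cyclic_edges (vs @ [v]) = path_edges vs \<union> (\<lambda>u. {u, v}) ` {last vs, hd vs}"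
    using snoc.hyps by (auto simp: cyclic_edges_eq path_edges_snoc)
  then have "chromatic_count (set (vs @ [v])) (cyclic_edges (vs @ [v])) q =
      (\<Sum>\<kappa>\<in>?P. ?Q - of_nat (card (\<kappa> ` {last vs, hd vs})))"
    using chromatic_count_new_vertex[OF finite_set v path_edges_subset, of "{last vs, hd vs}" q]
      ends by simp
  \<comment> \<open>One colour is always lost; a second one exactly if the ends of the path differ.\<close>
  also have "\<dots> = (\<Sum>\<kappa>\<in>?P. (?Q - 1) - (if \<kappa> (last vs) \<noteq> \<kappa> (hd vs) then 1 else 0))"
    by (rule sum.cong) auto
  also have "\<dots> = (?Q - 1) * of_nat (card ?P) -
      of_nat (card {\<kappa> \<in> ?P. \<kappa> (last vs) \<noteq> \<kappa> (hd vs)})"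
    using fin by (simp add: sum_subtractf sum.If_cases Int_def)
  also have "{\<kappa> \<in> ?P. \<kappa> (last vs) \<noteq> \<kappa> (hd vs)} = ?C"
  proof -
    have "{u, w} \<in> cyclic_edges vs \<longleftrightarrow> (u = last vs \<and> w = hd vs) \<or> (u = hd vs \<and> w = last vs) \<or>
        {u, w} \<in> path_edges vs" for u w
      using snoc.hyps by (auto simp: cyclic_edges_eq doubleton_eq_iff)
    then show ?thesis using ends unfolding bounded_colourings_def by auto
  qed
  also have "(?Q - 1) * of_nat (card ?P) - of_nat (card ?C) =
      (?Q - 1) * (?Q * (?Q - 1) ^ (length vs - 1)) -
      ((?Q - 1) ^ length vs + (-1) ^ length vs * (?Q - 1))"
    using chromatic_count_path[of vs q] snoc by (simp add: chromatic_count_def)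
  also have "\<dots> = (?Q - 1) ^ length (vs @ [v]) + (-1) ^ length (vs @ [v]) * (?Q - 1)"
    using snoc.hyps by (cases vs) (simp_all add: algebra_simps)
  finally show ?case .
qed

section \<open>Connectivity and the unique cycle\<close>

abbreviation adjacency :: "'a set set \<Rightarrow> ('a \<times> 'a) set" where
  "adjacency F \<equiv> {(x, y). {x, y} \<in> F}"

lemma reachable_sym: "(u, v) \<in> (adjacency F)\<^sup>* \<Longrightarrow> (v, u) \<in> (adjacency F)\<^sup>*"
  by (rule symD[OF sym_rtrancl]) (auto simp: sym_def insert_commute)

lemma reachable_mono: "F \<subseteq> F' \<Longrightarrow> (u, v) \<in> (adjacency F)\<^sup>* \<Longrightarrow> (u, v) \<in> (adjacency F')\<^sup>*"
  by (rule subsetD[OF rtrancl_mono]) auto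

text \<open>A walk is made repetition-free while it grows: returning to a vertex already visited cuts the
  path off at that vertex.\<close>

lemma reachable_by_path:
  assumes "(u, v) \<in> (adjacency F)\<^sup>*"
  obtains vs where "vs \<noteq> []" "distinct vs" "hd vs = u" "last vs = v" "path_edges vs \<subseteq> F"
proof -
  have "\<exists>vs. vs \<noteq> [] \<and> distinct vs \<and> hd vs = u \<and> last vs = v \<and> path_edges vs \<subseteq> F"
    using assms
  proof (induction rule: rtrancl_induct)
    case base
    show ?case by (rule exI[of _ "[u]"]) simp
  next
    case (step y z)
    then obtain vs where vs: "vs \<noteq> []" "distinct vs" "hd vs = u" "last vs = y" "path_edges vs \<subseteq> F"
      by blast
    show ?case
    proof (cases "z \<in> set vs")
      case True
      then obtain xs ys where split: "vs = (xs @ [z]) @ ys" by (auto dest: split_list)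
      then have "path_edges (xs @ [z]) \<subseteq> F" using vs(5) path_edges_append_subset by blast
      moreover have "hd (xs @ [z]) = u" using vs(3) split by (cases xs) auto
      ultimately show ?thesis using vs(2) split by (intro exI[of _ "xs @ [z]"]) auto
    next
      case False
      then show ?thesis using vs step.hyps(2)
        by (intro exI[of _ "vs @ [z]"]) (auto simp: path_edges_snoc)
    qed
  qed
  then show thesis using that by blast
qed

text \<open>The source of all cycles: an edge between two vertices that are already connected without it
  closes a path to a cycle. The path has at least three vertices, since otherwise it would consist
  of the edge \<open>{u, v}\<close> itself.\<close>

lemma cycle_closing_edge:
  assumes "F \<subseteq> E" and "(u, v) \<in> (adjacency F)\<^sup>*" and "u \<noteq> v"
    and "{u, v} \<in> E" and "{u, v} \<notin> F"
  obtains D where "is_cycle E D" "{u, v} \<in> D"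
proof -
  obtain vs where vs: "vs \<noteq> []" "distinct vs" "hd vs = u" "last vs = v" "path_edges vs \<subseteq> F"
    using reachable_by_path[OF assms(2)] .
  have eq: "cyclic_edges vs = insert {v, u} (path_edges vs)"
    using cyclic_edges_eq[OF vs(1)] vs(3,4) by simp
  have "length vs \<ge> 3"
  proof (rule ccontr)
    assume "\<not> length vs \<ge> 3"
    moreover have "length vs \<noteq> 0" using vs(1) by simp
    ultimately have "length vs = 1 \<or> length vs = 2" by linarith
    then have "vs = [u] \<or> vs = [u, v]"
      using vs(3,4) by (auto simp: length_Suc_conv numeral_2_eq_2)
    then show False
    proof
      assume "vs = [u]"
      then show False using vs(4) assms(3) by simp
    next
      assume "vs = [u, v]"
      then have "{u, v} \<in> path_edges vs" by (force simp: path_edges_def)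
      then show False using vs(5) assms(5) by blast
    qed
  qed
  then have "is_cycle E (cyclic_edges vs)"
    unfolding is_cycle_def using eq vs assms(1,4) by (auto simp: insert_commute)
  moreover have "{u, v} \<in> cyclic_edges vs" using eq by (simp add: insert_commute)
  ultimately show thesis by (rule that)
qed

lemma connected_graph_cycle:
  assumes "vs \<noteq> []"
  shows "connected_graph (set vs) (cyclic_edges vs)"
proof -
  have from_hd: "i < length vs \<Longrightarrow> (vs ! 0, vs ! i) \<in> (adjacency (cyclic_edges vs))\<^sup>*" for i
  proof (induction i)
    case (Suc i)
    then have "{vs ! i, vs ! Suc i} \<in> cyclic_edges vs"
      using cyclic_edges_eq[OF assms] by (auto simp: path_edges_def)
    then have "(vs ! i, vs ! Suc i) \<in> adjacency (cyclic_edges vs)" by simp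
    moreover have "(vs ! 0, vs ! i) \<in> (adjacency (cyclic_edges vs))\<^sup>*" using Suc by simp
    ultimately show ?case by (rule rtrancl_into_rtrancl[rotated])
  qed simp
  have "(u, v) \<in> (adjacency (cyclic_edges vs))\<^sup>*" if u: "u \<in> set vs" and v: "v \<in> set vs" for u v
  proof -
    obtain i where "i < length vs" "u = vs ! i"
      using u by (auto simp: in_set_conv_nth)
    moreover obtain j where "j < length vs" "v = vs ! j"
      using v by (auto simp: in_set_conv_nth)
    ultimately show ?thesis using rtrancl_trans[OF reachable_sym[OF from_hd[of i]] from_hd[of j]] by simp
  qed
  then show ?thesis unfolding connected_graph_def using assms by simp
qed

lemma connected_graph_pendant_vertex:
  assumes "connected_graph W F" and "u \<in> W"
  shows "connected_graph (insert w W) (insert {u, w} F)"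
proof -
  let ?F = "insert {u, w} F"
  have "(u, x) \<in> (adjacency ?F)\<^sup>*" if "x \<in> insert w W" for x
  proof (cases "x = w")
    case True
    then show ?thesis by (intro r_into_rtrancl) simp
  next
    case False
    then have "(u, x) \<in> (adjacency F)\<^sup>*" using that assms by (simp add: connected_graph_def)
    then show ?thesis by (rule reachable_mono[rotated]) blast
  qed
  then have "(x, y) \<in> (adjacency ?F)\<^sup>*" if "x \<in> insert w W" "y \<in> insert w W" for x y
    using rtrancl_trans[OF reachable_sym] that by metis
  then show ?thesis by (simp add: connected_graph_def)
qed

lemma connected_graph_boundary_edge:
  assumes "connected_graph V E" and "\<Union>E \<subseteq> V" and "W \<subset> V" and "W \<noteq> {}"
  obtains u w where "u \<in> W" "w \<in> V - W" "{u, w} \<in> E"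
proof (rule ccontr)
  assume none: "\<not> thesis"
  note crossing = that
  have closed: "z \<in> W" if "y \<in> W" "{y, z} \<in> E" for y z
  proof (rule ccontr)
    assume "z \<notin> W"
    moreover have "z \<in> V" using that(2) assms(2) by blast
    ultimately show False using none crossing that by simp
  qed
  obtain a where a: "a \<in> W" using assms(4) by blast
  obtain b where b: "b \<in> V" "b \<notin> W" using assms(3) by blast
  have "a \<in> V" using a assms(3) by blast
  then have "(a, b) \<in> (adjacency E)\<^sup>*" using assms(1) b(1) by (simp add: connected_graph_def)
  then have "b \<in> W"
    by (induction rule: rtrancl_induct) (use a closed in auto)
  then show False using b by simp
qed

text \<open>Growing a connected graph outwards from a cycle. As long as the subgraph does not contain
  all vertices, connectivity supplies an edge that leaves it, and adding only this one edge makes its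
  outer end a pendant vertex, whether or not \<open>E\<close> joins that vertex to the subgraph by further edges.\<close>

lemma connected_subgraphs_around_cycle:
  assumes "simple_graph V E" and "connected_graph V E"
    and "distinct vs" and "length vs \<ge> 3" and "cyclic_edges vs \<subseteq> E"
    and "length vs \<le> k" and "k \<le> card V"
  shows "\<exists>W F. W \<subseteq> V \<and> card W = k \<and> cyclic_edges vs \<subseteq> F \<and> F \<subseteq> E \<and> \<Union>F \<subseteq> W \<and>
    connected_graph W F \<and>
    (\<forall>q. chromatic_count W F q =
      chromatic_count (set vs) (cyclic_edges vs) q * (of_nat q - 1) ^ (k - length vs))"
  using assms(6,7)
proof (induction k rule: dec_induct)
  case base
  have EV: "\<Union>E \<subseteq> V" using assms(1) by (auto simp: simple_graph_def)
  have ne: "vs \<noteq> []" using assms(4) by auto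
  have "set vs \<subseteq> V" using assms(5) EV Union_cyclic_edges[of vs] by blast
  moreover have "card (set vs) = length vs" using assms(3) by (rule distinct_card)
  moreover have "\<Union>(cyclic_edges vs) \<subseteq> set vs" using Union_cyclic_edges[of vs] by (rule equalityD1)
  ultimately show ?case
    using assms(5) connected_graph_cycle[OF ne]
    by (intro exI[of _ "set vs"] exI[of _ "cyclic_edges vs"] conjI allI) simp_all
next
  case (step k)
  have "k \<le> card V" using step.prems by simp
  from step.IH[OF this]
  obtain W F where WF: "W \<subseteq> V" "card W = k" "cyclic_edges vs \<subseteq> F" "F \<subseteq> E" "\<Union>F \<subseteq> W"
    "connected_graph W F"
    and count: "\<And>q. chromatic_count W F q =
      chromatic_count (set vs) (cyclic_edges vs) q * (of_nat q - 1) ^ (k - length vs)"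
    by blast
  have finV: "finite V" and EV: "\<Union>E \<subseteq> V" using assms(1) by (auto simp: simple_graph_def)
  have finW: "finite W" using WF(1) finV by (rule finite_subset)
  have "W \<subset> V" using WF(1,2) step.prems by auto
  moreover have "W \<noteq> {}" using WF(6) by (simp add: connected_graph_def)
  ultimately obtain u w where "u \<in> W" "w \<in> V - W" "{u, w} \<in> E"
    by (rule connected_graph_boundary_edge[OF assms(2) EV])
  then have uw: "u \<in> W" "w \<in> V" "w \<notin> W" "{u, w} \<in> E" by simp_all
  have "chromatic_count (insert w W) (insert {u, w} F) q =
      chromatic_count (set vs) (cyclic_edges vs) q * (of_nat q - 1) ^ (Suc k - length vs)" for q
    using chromatic_count_pendant_vertex[OF finW _ WF(5) uw(1), of w q] uw(3) count[of q]
      step.hyps by (simp add: Suc_diff_le)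
  moreover have "card (insert w W) = Suc k" using uw(3) WF(2) finW by simp
  moreover have "\<Union>(insert {u, w} F) \<subseteq> insert w W" using WF(5) uw(1) by auto
  moreover have "cyclic_edges vs \<subseteq> insert {u, w} F" "insert {u, w} F \<subseteq> E" "insert w W \<subseteq> V"
    using WF(1,3,4) uw(2,4) by auto
  ultimately show ?case
    using connected_graph_pendant_vertex[OF WF(6) uw(1)]
    by (intro exI[of _ "insert w W"] exI[of _ "insert {u, w} F"] conjI allI)
qed

text \<open>No edge is missed when growing from the unique cycle: an edge outside a connected spanning
  subgraph would close a cycle through that edge, different from the cycle inside the subgraph.\<close>

lemma connected_spanning_subgraph_of_unicyclic:
  assumes "simple_graph V E" and "unicyclic E" and "is_cycle E C"
    and "connected_graph V F" and "C \<subseteq> F" and "F \<subseteq> E"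
  shows "F = E"
proof
  show "E \<subseteq> F"
  proof
    fix e assume e: "e \<in> E"
    then obtain u v where uv: "e = {u, v}" "u \<noteq> v" "u \<in> V" "v \<in> V"
      using assms(1) by (auto simp: simple_graph_def card_2_iff)
    show "e \<in> F"
    proof (rule ccontr)
      assume "e \<notin> F"
      moreover have "(u, v) \<in> (adjacency F)\<^sup>*" using assms(4) uv by (simp add: connected_graph_def)
      ultimately obtain D where "is_cycle E D" "e \<in> D"
        using cycle_closing_edge[OF assms(6)] uv e by metis
      then show False using assms(2,3,5) \<open>e \<notin> F\<close> by (auto simp: unicyclic_def)
    qed
  qed
qed (rule assms(6))

lemma chromatic_count_unicyclic:
  assumes "simple_graph V E" and "connected_graph V E" and "unicyclic E" and "is_cycle E C"
  shows "card C \<le> card V"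
    and "chromatic_count V E q =
      ((of_nat q - 1) ^ card C + (-1) ^ card C * (of_nat q - 1)) *
      (of_nat q - 1) ^ (card V - card C)"
proof -
  obtain vs where vs: "distinct vs" "length vs \<ge> 3" "C = cyclic_edges vs" and CE: "C \<subseteq> E"
    using assms(4) by (auto simp: is_cycle_def)
  have finV: "finite V" and EV: "\<Union>E \<subseteq> V" using assms(1) by (auto simp: simple_graph_def)
  have cC: "card C = length vs" using card_cyclic_edges vs by simp
  have "set vs \<subseteq> V" using CE EV vs(3) Union_cyclic_edges[of vs] by blast
  then show le: "card C \<le> card V"
    using card_mono[OF finV] distinct_card[OF vs(1)] cC by metis
  obtain W F where WF: "W \<subseteq> V" "card W = card V" "C \<subseteq> F" "F \<subseteq> E" "connected_graph W F"
    and count: "\<And>q. chromatic_count W F q =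
      chromatic_count (set vs) C q * (of_nat q - 1) ^ (card V - card C)"
    using connected_subgraphs_around_cycle[OF assms(1,2) vs(1,2), of "card V"] CE le
    unfolding cC vs(3)[symmetric] by blast
  have "W = V" using card_subset_eq[OF finV WF(1,2)] .
  moreover have "F = E"
    using connected_spanning_subgraph_of_unicyclic[OF assms(1,3,4) _ WF(3,4)] WF(5) \<open>W = V\<close> by simp
  moreover have "vs \<noteq> []" using vs(2) by auto
  ultimately show "chromatic_count V E q =
      ((of_nat q - 1) ^ card C + (-1) ^ card C * (of_nat q - 1)) *
      (of_nat q - 1) ^ (card V - card C)"
    using count[of q] chromatic_count_cycle[OF _ vs(1), of q] cC vs(3) by simp
qed

section \<open>Comparison of coefficients\<close>

text \<open>The coefficients enter only through the sums over partitions of equal length, because the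
  weight of a star forest depends only on the number of its components.\<close>

lemma chromatic_count_star_expansion:
  fixes a :: "nat list \<Rightarrow> rat"
  assumes "finite V" and "card V = n"
    and "chromatic_symmetric V E = (\<lambda>m. \<Sum>p\<in>partitions_of n. a p * star_sym p m)"
  shows "chromatic_count V E q =
    (\<Sum>l\<le>n. (\<Sum>p | p \<in> partitions_of n \<and> length p = l. a p) *
      (of_nat q ^ l * (of_nat q - 1) ^ (n - l)))"
proof -
  let ?w = "\<lambda>l. of_nat q ^ l * (of_nat q - 1) ^ (n - l) :: rat"
  have star: "(\<Sum>m\<in>monomials n q. star_sym p m) = ?w (length p)" if "p \<in> partitions_of n" for p
  proof -
    have p: "\<forall>k\<in>set p. k \<ge> 1" "sum_list p = n" using that by (auto simp: partitions_of_def)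
    show ?thesis
      using sum_chromatic_symmetric[OF finite_star_forest_verts, of p n]
        chromatic_count_star_forest[OF p(1)] p(2)
      by (simp add: star_sym_def card_star_forest_verts)
  qed
  have "chromatic_count V E q = (\<Sum>m\<in>monomials n q. \<Sum>p\<in>partitions_of n. a p * star_sym p m)"
    using sum_chromatic_symmetric[OF assms(1,2), of E q] assms(3) by simp
  also have "\<dots> = (\<Sum>p\<in>partitions_of n. a p * (\<Sum>m\<in>monomials n q. star_sym p m))"
    by (subst sum.swap) (simp add: sum_distrib_left)
  also have "\<dots> = (\<Sum>p\<in>partitions_of n. a p * ?w (length p))"
    by (simp add: star)
  also have "\<dots> = (\<Sum>l\<le>n. \<Sum>p | p \<in> partitions_of n \<and> length p = l. a p * ?w (length p))"
    using length_le_sum_list finite_partitions_of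
    by (intro sum.group[symmetric]) (auto simp: partitions_of_def)
  also have "\<dots> = (\<Sum>l\<le>n. (\<Sum>p | p \<in> partitions_of n \<and> length p = l. a p) * ?w l)"
    by (intro sum.cong) (simp_all add: sum_distrib_right)
  finally show ?thesis .
qed

lemma poly_eq_of_infinite:
  fixes f g :: "rat poly"
  assumes "infinite Y" and "\<And>y. y \<in> Y \<Longrightarrow> poly f y = poly g y"
  shows "f = g"
proof (rule ccontr)
  assume "f \<noteq> g"
  then have "finite {y. poly (f - g) y = 0}" by (intro poly_roots_finite) simp
  moreover have "Y \<subseteq> {y. poly (f - g) y = 0}" using assms(2) by auto
  ultimately show False using assms(1) finite_subset by blast
qed

theorem lemma4p21:
  fixes V :: "'a set" and E C :: "'a set set" and n c l :: nat
    and coeff :: "nat list \<Rightarrow> rat"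
  assumes "simple_graph V E" and "connected_graph V E" and "unicyclic E"
    and "card V = n"
    and "is_cycle E C" and "card C = c"
    and "1 \<le> l" and "l \<le> n"
    and "chromatic_symmetric V E = (\<lambda>m. \<Sum>p\<in>partitions_of n. coeff p * star_sym p m)"
  shows "(\<Sum>p | p \<in> partitions_of n \<and> length p = l. coeff p) =
    (-1) ^ (l - 1) * of_nat ((c - 1) choose l)"
proof -
  define \<sigma> where "\<sigma> l = (\<Sum>p | p \<in> partitions_of n \<and> length p = l. coeff p)" for l
  define f where "f = (\<Sum>l\<le>n. monom (\<sigma> l) l)"
  define g :: "rat poly" where "g = 1 - [:1, -1:] ^ (c - 1)"
  \<comment> \<open>With \<open>t = q - 1\<close>, the value \<open>?y t\<close> is \<open>q / (q - 1)\<close>.\<close>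
  let ?y = "\<lambda>t. (of_nat t + 1) / of_nat t :: rat"
  have finV: "finite V" using assms(1) by (simp add: simple_graph_def)
  obtain vs where "distinct vs" "length vs \<ge> 3" "C = cyclic_edges vs"
    using assms(5) by (auto simp: is_cycle_def)
  then have "c \<ge> 3" using card_cyclic_edges[of vs] assms(6) by simp
  have cn: "c \<le> n" using chromatic_count_unicyclic(1)[OF assms(1-3,5)] assms(4,6) by simp
  have "poly f y = poly g y" if "y \<in> ?y ` {1..}" for y
  proof -
    obtain t :: nat where t: "t \<ge> 1" "y = ?y t" using \<open>y \<in> ?y ` {1..}\<close> by (elim imageE) simp
    define T :: rat where "T = of_nat t"
    have T: "T \<noteq> 0" using t(1) by (simp add: T_def)
    have y: "y = (T + 1) / T" using t(2) by (simp add: T_def)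
    have yT: "y * T = T + 1" using T by (simp add: y)
    have "y ^ l * T ^ n = (T + 1) ^ l * T ^ (n - l)" if "l \<le> n" for l
    proof -
      have "T ^ n = T ^ l * T ^ (n - l)" using that by (simp flip: power_add)
      then have "y ^ l * T ^ n = (y * T) ^ l * T ^ (n - l)" by (simp add: power_mult_distrib)
      then show ?thesis by (simp only: yT)
    qed
    then have "poly f y * T ^ n = (\<Sum>l\<le>n. \<sigma> l * ((T + 1) ^ l * T ^ (n - l)))"
      by (simp add: f_def poly_sum poly_monom sum_distrib_right mult.assoc)
    also have "\<dots> = chromatic_count V E (t + 1)"
      using chromatic_count_star_expansion[OF finV assms(4,9), of "t + 1"]
      by (simp add: \<sigma>_def T_def add.commute)
    also have "\<dots> = (T ^ c + (-1) ^ c * T) * T ^ (n - c)"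
      using chromatic_count_unicyclic(2)[OF assms(1-3,5), of "t + 1"] assms(4,6)
      by (simp add: T_def)
    also have "\<dots> = (1 - (- 1 / T) ^ (c - 1)) * T ^ n"
    proof -
      obtain d where d: "c = Suc d" using \<open>c \<ge> 3\<close> by (cases c) auto
      have "(- 1 / T) ^ d * T ^ d = (- 1) ^ d"
        using T by (simp flip: power_mult_distrib)
      moreover have "T ^ n = T ^ d * (T * T ^ (n - c))"
        using cn d by (simp flip: power_Suc power_add)
      ultimately show ?thesis using d by (simp add: algebra_simps)
    qed
    also have "1 - (- 1 / T) ^ (c - 1) = poly g y"
    proof -
      have "1 - y = - 1 / T" using T by (simp add: y add_divide_distrib)
      then show ?thesis by (simp add: g_def)
    qed
    finally show ?thesis using T by simp
  qed
  moreover have "infinite (?y ` {1..})"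
  proof
    assume "finite (?y ` {1..})"
    moreover have "inj_on ?y {1..}" by (rule inj_onI) (simp add: add_divide_distrib)
    ultimately have "finite {1 :: nat..}" by (rule finite_imageD)
    then show False by (simp add: infinite_Ici)
  qed
  ultimately have "f = g" using poly_eq_of_infinite by blast
  then have "poly.coeff f l = poly.coeff g l" by simp
  moreover have "poly.coeff f l = \<sigma> l"
    using assms(8) by (simp add: f_def coeff_sum)
  moreover have "poly.coeff g l = - (of_nat ((c - 1) choose l) * (-1) ^ l)"
  proof -
    have "poly.coeff ([:1, -1:] ^ (c - 1)) l = of_nat ((c - 1) choose l) * (-1 :: rat) ^ l"
    proof (cases "l \<le> c - 1")
      case True
      then show ?thesis by (simp add: coeff_linear_poly_power)
    next
      case False
      moreover have "degree ([:1, -1 :: rat:] ^ (c - 1)) \<le> c - 1"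
        using degree_power_le[of "[:1, -1 :: rat:]" "c - 1"] by simp
      ultimately show ?thesis by (simp add: coeff_eq_0 binomial_eq_0)
    qed
    then show ?thesis using assms(7) by (simp add: g_def)
  qed
  moreover have "- (of_nat ((c - 1) choose l) * (-1) ^ l) =
      (-1) ^ (l - 1) * (of_nat ((c - 1) choose l) :: rat)"
    using assms(7) by (cases l) auto
  ultimately show ?thesis by (simp add: \<sigma>_def)
qed

end
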